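(* Let $r\ge 1$ and $\delta\ge 2$ be integers and let $\mathcal{C}$ be an $[n,k,d_{\min}]$ linear code over $\mathbb{F}_q$ with $(r,\delta)$ information locality. Then $$d_{\min}\ \le\ n-k+1-\left(\left\lceil \frac{k}{r}\right\rceil-1\right)(\delta-1).$$
   Context: An $[n,k,d_{\min}]$ (scalar) code over the finite field $\mathbb{F}_q$ is a linear code of length $n$, dimension $k$ and minimum Hamming distance $d_{\min}$; $G$ denotes a $k\times n$ generator matrix of $\mathcal{C}$, and for $S\subseteq[n]=\{1,\dots,n\}$, $G|_S$ is the submatrix of columns indexed by $S$, and $\mathcal{C}|_S$ is the code obtained by puncturing $\mathcal{C}$ to the coordinates in $S$ (restricting all codewords to $S$). The code $\mathcal{C}$ has $(r,\delta)$ information locality if it has a family of punctured codes $\{\mathcal{C}_i=\mathcal{C}|_{S_i}\}_{i\in\mathcal{L}}$ (called local codes, with supports $S_i\subseteq[n]$ and finite index set $\mathcal{L}$) such that for all $i\in\mathcal{L}$: $|S_i|\le r+\delta-1$ and $d_{\min}(\mathcal{C}_i)\ge\delta$; and moreover $\mathrm{Rank}(G|_{\cup_{i\in\mathcal{L}}S_i})=k$. *)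

theory Defs
  imports
    "HOL-Library.Extended_Nat"
    "Jordan_Normal_Form.DL_Rank"
    "Jordan_Normal_Form.DL_Submatrix"
begin

(* Coordinates are 0-based: the index set [n] is {..<n}. *)

definition hamming_dist :: "'a vec \<Rightarrow> 'a vec \<Rightarrow> nat" where
  "hamming_dist x y = card {i. i < dim_vec x \<and> x $ i \<noteq> y $ i}"

(* Values in enat: a code with at most one codeword has no pair of distinct codewords,
   and its minimum distance is \<infinity> (infimum of the empty set). *)
definition min_dist :: "'a vec set \<Rightarrow> enat" where
  "min_dist C = Inf {enat (hamming_dist x y) | x y. x \<in> C \<and> y \<in> C \<and> x \<noteq> y}"

(* An [n,k,d] code. As d is a natural number, the zero code is excluded, so k > 0. *)
definition linear_code :: "nat \<Rightarrow> nat \<Rightarrow> nat \<Rightarrow> 'a::{field,finite} vec set \<Rightarrow> bool" where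
  "linear_code n k d C \<longleftrightarrow>
     VectorSpace.subspace class_ring C (module_vec TYPE('a) n) \<and>
     vectorspace.dim class_ring ((module_vec TYPE('a) n)\<lparr>carrier := C\<rparr>) = k \<and>
     min_dist C = enat d"

(* When C has dimension k, the k rows of G necessarily form a basis of C. *)
definition generator_matrix :: "nat \<Rightarrow> nat \<Rightarrow> 'a::{field,finite} vec set \<Rightarrow> 'a mat \<Rightarrow> bool" where
  "generator_matrix n k C G \<longleftrightarrow> G \<in> carrier_mat k n \<and> vec_space.row_space n G = C"

(* Restriction of a vector to the coordinates in S, in increasing order; "pick S j" is the
   j-th smallest element of S, as in submatrix. *)
definition puncture_vec :: "nat set \<Rightarrow> 'a vec \<Rightarrow> 'a vec" where
  "puncture_vec S v = vec (card {i. i < dim_vec v \<and> i \<in> S}) (\<lambda>j. v $ pick S j)"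

definition punctured_code :: "'a vec set \<Rightarrow> nat set \<Rightarrow> 'a vec set" where
  "punctured_code C S = puncture_vec S ` C"

(* "submatrix G UNIV T" keeps all k rows of G and the columns indexed by T; the first argument
   of vec_space.rank is the number of rows. *)
definition information_locality ::
  "nat \<Rightarrow> nat \<Rightarrow> 'a::{field,finite} vec set \<Rightarrow> 'a mat \<Rightarrow> nat \<Rightarrow> nat \<Rightarrow> bool" where
  "information_locality n k C G r \<delta> \<longleftrightarrow>
     (\<exists>(L :: nat set) (S :: nat \<Rightarrow> nat set).
        finite L \<and>
        (\<forall>i\<in>L. S i \<subseteq> {..<n} \<and> card (S i) \<le> r + \<delta> - 1 \<and>
               enat \<delta> \<le> min_dist (punctured_code C (S i))) \<and>
        vec_space.rank k (submatrix G UNIV (\<Union>i\<in>L. S i)) = k)"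

end

theory Submission
  imports Defs "HOL-Library.Cardinality"
begin

text \<open>Write $K(T)$ for the set of codewords vanishing on $T$ and $q$ for the field size, so that
  $\log_q |C| - \log_q |K(T)|$ is the rank of the columns indexed by $T$. Adding one coordinate to
  $T$ shrinks $K(T)$ at most by the factor $q$. Inside a local support $S$, any $\delta - 1$
  coordinates are determined by the others; hence adding $S$ to $T$ either changes nothing or
  increases $|T|$ by at least $\delta - 1$ more than the rank, and the rank by at most $r$.
  Greedily adding local supports while $K(T) \neq 0$ takes at least $\lceil k/r \rceil - 1$
  steps; filling up with single coordinates then gives a set $T$ with $K(T) \neq 0$ and
  $|T| \ge k - 1 + (\lceil k/r \rceil - 1)(\delta - 1)$. A nonzero codeword in $K(T)$ has weight
  at most $n - |T|$.\<close>

section \<open>Minimum distance and subcodes vanishing on a coordinate set\<close>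

lemma min_dist_le_hamming_dist:
  assumes "enat \<delta> \<le> min_dist C" "x \<in> C" "y \<in> C" "x \<noteq> y"
  shows "\<delta> \<le> hamming_dist x y"
proof -
  have "min_dist C \<le> enat (hamming_dist x y)"
    unfolding min_dist_def using assms(2-4) by (intro Inf_lower) blast
  with assms(1) show ?thesis
    by (metis enat_ord_simps(1) order_trans)
qed

text \<open>This is $K(T)$: the code shortened at \<open>T\<close>, but with the coordinates of
  \<open>T\<close> kept. All subcodes thus have length \<open>n\<close>, and the operation can be
  iterated as in \<open>vanishing_on_Un\<close>.\<close>

definition vanishing_on :: "'a::zero vec set \<Rightarrow> nat set \<Rightarrow> 'a vec set" where
  "vanishing_on C T = {c \<in> C. \<forall>j\<in>T. c $ j = 0}"

lemma vanishing_on_Un: "vanishing_on C (T \<union> S) = vanishing_on (vanishing_on C T) S"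
  by (auto simp: vanishing_on_def)

lemma finite_vanishing_on: "finite C \<Longrightarrow> finite (vanishing_on C T)"
  by (simp add: vanishing_on_def)

section \<open>Counting codewords: the cost of each new zero coordinate\<close>

text \<open>Subtracting one fixed codeword with value \<open>a\<close> at \<open>j\<close> injects
  all codewords with that value into those vanishing at \<open>j\<close>, and there are
  \<open>CARD('a)\<close> values. Assuming closure under differences rather than a subspace makes
  the bound easy to apply to \<open>vanishing_on C T\<close>.\<close>

lemma card_le_card_vanishing_on_singleton:
  fixes C :: "'a::{field,finite} vec set"
  assumes fin: "finite C" and carrier: "C \<subseteq> carrier_vec n"
    and diff: "\<And>x y. x \<in> C \<Longrightarrow> y \<in> C \<Longrightarrow> x - y \<in> C"
    and j: "j < n"
  shows "card C \<le> CARD('a) * card (vanishing_on C {j})"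
proof -
  have fibre: "card {c \<in> C. c $ j = a} \<le> card (vanishing_on C {j})" for a
  proof (cases "{c \<in> C. c $ j = a} = {}")
    case True
    then show ?thesis by (simp only: card.empty zero_le)
  next
    case False
    then obtain y where y: "y \<in> C" "y $ j = a" by blast
    show ?thesis
    proof (rule card_inj_on_le[of "\<lambda>x. x - y"])
      show "inj_on (\<lambda>x. x - y) {c \<in> C. c $ j = a}"
      proof (rule inj_onI)
        fix x x' assume "x \<in> {c \<in> C. c $ j = a}" "x' \<in> {c \<in> C. c $ j = a}"
          and e: "x - y = x' - y"
        then have c: "x \<in> carrier_vec n" "x' \<in> carrier_vec n" "y \<in> carrier_vec n"
          using carrier y by auto
        show "x = x'"
        proof (rule eq_vecI)
          fix i assume i: "i < dim_vec x'"
          have "(x - y) $ i = (x' - y) $ i" using e by simp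
          with c i show "x $ i = x' $ i" by auto
        qed (use c in auto)
      qed
      show "(\<lambda>x. x - y) ` {c \<in> C. c $ j = a} \<subseteq> vanishing_on C {j}"
        using y carrier j diff by (auto simp: vanishing_on_def subset_iff)
      show "finite (vanishing_on C {j})"
        using fin by (rule finite_vanishing_on)
    qed
  qed
  have "C = (\<Union>a\<in>UNIV. {c \<in> C. c $ j = a})" by auto
  then have "card C \<le> (\<Sum>a\<in>(UNIV::'a set). card {c \<in> C. c $ j = a})"
    using card_UN_le[of "UNIV :: 'a set" "\<lambda>a. {c \<in> C. c $ j = a}"] by simp
  also have "\<dots> \<le> (\<Sum>a\<in>(UNIV::'a set). card (vanishing_on C {j}))"
    by (intro sum_mono fibre)
  finally show ?thesis by simp
qed

text \<open>One factor \<open>CARD('a)\<close> is lost per coordinate, because the previous bound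
  applies to the subcode \<open>vanishing_on C R\<close> as well. In rank terms, the columns indexed
  by \<open>R\<close> have rank at most $|R|$.\<close>

lemma card_le_card_vanishing_on:
  fixes C :: "'a::{field,finite} vec set"
  assumes fin: "finite C" and carrier: "C \<subseteq> carrier_vec n"
    and diff: "\<And>x y. x \<in> C \<Longrightarrow> y \<in> C \<Longrightarrow> x - y \<in> C"
    and R: "R \<subseteq> {..<n}"
  shows "card C \<le> CARD('a) ^ card R * card (vanishing_on C R)"
proof -
  have "finite R" using R finite_subset by blast
  then show ?thesis using R
  proof induction
    case empty
    then show ?case by (simp add: vanishing_on_def)
  next
    case (insert j R)
    have "card (vanishing_on C R) \<le> CARD('a) * card (vanishing_on (vanishing_on C R) {j})"
    proof (rule card_le_card_vanishing_on_singleton)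
      show "vanishing_on C R \<subseteq> carrier_vec n"
        using carrier by (auto simp: vanishing_on_def)
      fix x y assume "x \<in> vanishing_on C R" "y \<in> vanishing_on C R"
      then show "x - y \<in> vanishing_on C R"
        using diff carrier insert.prems
        by (auto simp: vanishing_on_def subset_iff)
    qed (use insert.prems finite_vanishing_on[OF fin] in auto)
    also have "vanishing_on (vanishing_on C R) {j} = vanishing_on C (insert j R)"
      by (auto simp: vanishing_on_def)
    finally have "CARD('a) ^ card R * card (vanishing_on C R)
        \<le> CARD('a) ^ card R * (CARD('a) * card (vanishing_on C (insert j R)))"
      by (rule mult_le_mono2)
    with insert.IH insert.prems have "card C
        \<le> CARD('a) ^ card R * (CARD('a) * card (vanishing_on C (insert j R)))"
      by (meson insert_subset le_trans)
    with insert.hyps show ?case by (simp add: algebra_simps)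
  qed
qed

lemma card_carrier_vec: "card (carrier_vec k :: 'a::finite vec set) = CARD('a) ^ k"
proof -
  have "bij_betw (vec k) ({..<k} \<rightarrow>\<^sub>E (UNIV :: 'a set)) (carrier_vec k)"
    by (rule bij_betw_byWitness[where f' = "\<lambda>v. restrict (($) v) {..<k}"])
      (auto simp: fun_eq_iff PiE_def extensional_def)
  then have "card (carrier_vec k :: 'a vec set) = card ({..<k} \<rightarrow>\<^sub>E (UNIV :: 'a set))"
    by (simp add: bij_betw_same_card)
  then show ?thesis by (simp add: card_PiE)
qed

lemma finite_carrier_vec: "finite (carrier_vec k :: 'a::finite vec set)"
proof (rule card_ge_0_finite)
  show "0 < card (carrier_vec k :: 'a vec set)"
    by (simp add: card_carrier_vec)
qed

section \<open>Erasure correction in a local code\<close>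

text \<open>Restricted to \<open>S\<close>, the codeword can be nonzero only in
  \<open>S - T\<close>. Its distance to the zero word of the local code is therefore below
  \<open>\<delta>\<close>, so the two restrictions coincide.\<close>

lemma local_code_erasure:
  assumes carrier: "C \<subseteq> carrier_vec n" and zero: "0\<^sub>v n \<in> C"
    and S: "S \<subseteq> {..<n}" and dist: "enat \<delta> \<le> min_dist (punctured_code C S)"
    and R: "card (S - T) < \<delta>"
    and c: "c \<in> vanishing_on C T"
  shows "c \<in> vanishing_on C S"
proof -
  have cC: "c \<in> C" and cT: "\<And>j. j \<in> T \<Longrightarrow> c $ j = 0"
    using c by (auto simp: vanishing_on_def)
  have cn: "dim_vec c = n" using cC carrier by auto
  have finS: "finite S" using S finite_subset by blast
  have Sn: "{i. i < n \<and> i \<in> S} = S" using S by auto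
  let ?x = "puncture_vec S c" and ?z = "puncture_vec S (0\<^sub>v n :: 'a vec)"
  have x: "?x = vec (card S) (\<lambda>j. c $ pick S j)"
    by (simp add: puncture_vec_def cn Sn)
  have z: "?z = vec (card S) (\<lambda>j. (0\<^sub>v n :: 'a vec) $ pick S j)"
    by (simp add: puncture_vec_def Sn)
  \<comment> \<open>Needed because entries of \<open>0\<^sub>v n\<close> are specified only at
    indices below \<open>n\<close>.\<close>
  have pick_less: "pick S j < n" if "j < card S" for j
    using pick_in_set_le[OF that] S by auto
  let ?D = "{j. j < card S \<and> c $ pick S j \<noteq> 0}"
  have "hamming_dist ?x ?z = card ?D"
    unfolding hamming_dist_def x z
    by (rule arg_cong[where f = card]) (auto simp: pick_less)
  also have "\<dots> \<le> card (S - T)"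
  proof (rule card_inj_on_le)
    show "inj_on (pick S) ?D"
      by (rule inj_onI) (metis (mono_tags, lifting) mem_Collect_eq nat_neq_iff pick_mono_le)
    show "pick S ` ?D \<subseteq> S - T"
      using pick_in_set_le cT by blast
  qed (use finS in simp)
  finally have "\<not> \<delta> \<le> hamming_dist ?x ?z" using R by simp
  moreover have "?x \<in> punctured_code C S" "?z \<in> punctured_code C S"
    using cC zero by (auto simp: punctured_code_def)
  ultimately have eq: "?x = ?z"
    using min_dist_le_hamming_dist[OF dist] by blast
  have "c $ i = 0" if i: "i \<in> S" for i
  proof -
    \<comment> \<open>The position of coordinate \<open>i\<close> after puncturing to
      \<open>S\<close>.\<close>
    define j where "j = card {a \<in> S. a < i}"
    have j: "pick S j = i" unfolding j_def by (rule pick_card_in_set[OF i])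
    have "j < card S" unfolding j_def
      using finS i by (intro psubset_card_mono) auto
    moreover have "?x $ j = ?z $ j" using eq by simp
    ultimately show ?thesis using x z j S i by auto
  qed
  then show ?thesis using cC by (simp add: vanishing_on_def)
qed

section \<open>Full rank columns and information sets\<close>

text \<open>The columns span the whole space, so \<open>v\<close> is orthogonal to every vector, in
  particular to the unit vectors.\<close>

lemma full_rank_orthogonal_imp_zero:
  fixes A :: "'a::field mat"
  assumes A: "A \<in> carrier_mat k m" and rank: "vec_space.rank k A = k"
    and v: "v \<in> carrier_vec k"
    and orth: "\<And>j. j < m \<Longrightarrow> v \<bullet> col A j = 0"
  shows "v = 0\<^sub>v k"
proof -
  interpret vec_space "TYPE('a)" k .
  have cols: "set (cols A) \<subseteq> carrier_vec k" using A cols_dim by blast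
  obtain B where B: "maximal B (\<lambda>T. T \<subseteq> set (cols A) \<and> lin_indpt T)"
    using maximal_exists[of "\<lambda>T. T \<subseteq> set (cols A) \<and> lin_indpt T" "card (set (cols A))" "{}"]
    by (meson List.finite_set card_mono empty_iff empty_subsetI finite_lin_indpt2 rev_finite_subset)
  then have Bc: "B \<subseteq> set (cols A)" and li: "lin_indpt B"
    by (auto simp: maximal_def)
  \<comment> \<open>A maximal independent set of columns has as many elements as the rank, hence is
    a basis.\<close>
  have "card B = k" using rank_card_indpt[OF A B] rank by simp
  then have "basis B"
    using dim_li_is_basis[of B] Bc cols li dim_is_n finite_subset[OF Bc] by auto
  then have "span B = carrier_vec k" by (simp add: basis_def)
  then have full: "carrier_vec k \<subseteq> col_space A"
    unfolding col_space_def using span_is_monotone[OF Bc] by simp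
  have zero: "v \<bullet> y = 0" if y: "y \<in> carrier_vec k" for y
  proof -
    obtain x where x: "x \<in> carrier_vec m" "y = A *\<^sub>v x"
      using full y A unfolding col_space_eq[OF A] by auto
    have "A\<^sup>T *\<^sub>v v = 0\<^sub>v m"
    proof (rule eq_vecI)
      fix j assume "j < dim_vec (0\<^sub>v m :: 'a vec)"
      then have j: "j < m" by simp
      have "col A j \<bullet> v = v \<bullet> col A j"
        using v A j by (intro comm_scalar_prod[where n = k]) auto
      then show "(A\<^sup>T *\<^sub>v v) $ j = 0\<^sub>v m $ j"
        using A j orth[OF j] by simp
    qed (use A in simp)
    moreover have "v \<bullet> (A *\<^sub>v x) = (A\<^sup>T *\<^sub>v v) \<bullet> x"
      using transpose_vec_mult_scalar[OF A x(1) v] by simp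
    ultimately show ?thesis using x by simp
  qed
  show ?thesis
  proof (rule eq_vecI)
    fix i assume "i < dim_vec (0\<^sub>v k :: 'a vec)"
    then have i: "i < k" by simp
    then show "v $ i = 0\<^sub>v k $ i"
      using zero[of "unit_vec k i"] v by simp
  qed (use v in simp)
qed

text \<open>The entries on \<open>U\<close> of the codeword encoding \<open>y\<close> are the
  products of \<open>y\<close> with the columns in \<open>U\<close>; if they all vanish, then
  \<open>y\<close> is zero. This gives the first claim, and it makes encoding injective, which gives
  the second.\<close>

lemma full_rank_columns_information_set:
  fixes C :: "'a::{field,finite} vec set"
  assumes gen: "generator_matrix n k C G" and U: "U \<subseteq> {..<n}"
    and rank: "vec_space.rank k (submatrix G UNIV U) = k"
  shows "vanishing_on C U \<subseteq> {0\<^sub>v n}" and "CARD('a) ^ k \<le> card C"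
proof -
  have G: "G \<in> carrier_mat k n" using gen by (simp add: generator_matrix_def)
  have C: "C = {w \<in> carrier_vec n. \<exists>y\<in>carrier_vec k. G\<^sup>T *\<^sub>v y = w}"
    using gen G vec_space.row_space_eq[OF G] by (auto simp: generator_matrix_def)
  let ?A = "submatrix G UNIV U"
  have Un: "{j. j < n \<and> j \<in> U} = U" using U by auto
  have A: "?A \<in> carrier_mat k (card U)"
    using G by (intro carrier_matI) (auto simp: dim_submatrix Un)
  have finU: "finite U" using U finite_subset by blast
  have zero: "v = 0\<^sub>v k" if v: "v \<in> carrier_vec k" and van: "\<And>j. j \<in> U \<Longrightarrow> (G\<^sup>T *\<^sub>v v) $ j = 0"
    for v
  proof (rule full_rank_orthogonal_imp_zero[OF A rank v])
    fix j assume j: "j < card U"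
    have p: "pick U j \<in> U" using pick_in_set_le[OF j] .
    then have pn: "pick U j < n" using U by auto
    have "col ?A j = col G (pick U j)"
    proof (rule eq_vecI)
      fix i assume "i < dim_vec (col G (pick U j))"
      then have i: "i < k" using G by simp
      then have "?A $$ (i, j) = G $$ (pick UNIV i, pick U j)"
        using G j by (intro submatrix_index) (auto simp: Un)
      then show "col ?A j $ i = col G (pick U j) $ i"
        using A G i j pn by (simp add: pick_UNIV)
    qed (use A G in simp)
    moreover have "(G\<^sup>T *\<^sub>v v) $ pick U j = col G (pick U j) \<bullet> v"
      using G pn by simp
    moreover have "v \<bullet> col G (pick U j) = col G (pick U j) \<bullet> v"
      using v G by (intro comm_scalar_prod[where n = k]) auto
    ultimately show "v \<bullet> col ?A j = 0"
      using van[OF p] by simp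
  qed
  show "vanishing_on C U \<subseteq> {0\<^sub>v n}"
  proof
    fix c assume c: "c \<in> vanishing_on C U"
    then obtain y where y: "y \<in> carrier_vec k" "G\<^sup>T *\<^sub>v y = c"
      unfolding vanishing_on_def C by auto
    then have "y = 0\<^sub>v k" using zero[of y] c by (auto simp: vanishing_on_def)
    then show "c \<in> {0\<^sub>v n}" using y G by auto
  qed
  have inj: "inj_on ((*\<^sub>v) G\<^sup>T) (carrier_vec k)"
  proof (rule inj_onI)
    fix x y assume x: "x \<in> carrier_vec k" and y: "y \<in> carrier_vec k"
      and e: "G\<^sup>T *\<^sub>v x = G\<^sup>T *\<^sub>v y"
    have "G\<^sup>T *\<^sub>v (x - y) = G\<^sup>T *\<^sub>v x - G\<^sup>T *\<^sub>v y"
      using x y G by (intro mult_minus_distrib_mat_vec[where nr = n and nc = k]) auto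
    then have "G\<^sup>T *\<^sub>v (x - y) = 0\<^sub>v n"
      using e G y by simp
    \<comment> \<open>The difference encodes to the zero word, which vanishes on \<open>U\<close> in
      particular.\<close>
    then have "x - y = 0\<^sub>v k"
      using x y U by (intro zero) auto
    show "x = y"
    proof (rule eq_vecI)
      fix i assume i: "i < dim_vec y"
      have "(x - y) $ i = 0\<^sub>v k $ i" using \<open>x - y = 0\<^sub>v k\<close> by simp
      with i x y show "x $ i = y $ i" by auto
    qed (use x y in auto)
  qed
  have "card ((*\<^sub>v) G\<^sup>T ` carrier_vec k) \<le> card C"
  proof (rule card_mono)
    show "finite C" unfolding C using finite_carrier_vec by (rule rev_finite_subset) auto
    show "(*\<^sub>v) G\<^sup>T ` carrier_vec k \<subseteq> C" unfolding C using G by auto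
  qed
  then show "CARD('a) ^ k \<le> card C"
    using card_image[OF inj] by (simp add: card_carrier_vec)
qed

section \<open>Greedy union of local supports\<close>

text \<open>If fewer than \<open>\<delta>\<close> coordinates of \<open>S\<close> are new, erasure
  correction makes them zero already. Otherwise any \<open>\<delta> - 1\<close> of the new
  coordinates can be left out and recovered from the rest, so only the remaining ones cost a
  factor.\<close>

lemma add_local_support:
  fixes C :: "'a::{field,finite} vec set"
  assumes carrier: "C \<subseteq> carrier_vec n" and zero: "0\<^sub>v n \<in> C"
    and diff: "\<And>x y. x \<in> C \<Longrightarrow> y \<in> C \<Longrightarrow> x - y \<in> C"
    and S: "S \<subseteq> {..<n}" and T: "T \<subseteq> {..<n}"
    and dist: "enat \<delta> \<le> min_dist (punctured_code C S)"
    and ne: "vanishing_on C (T \<union> S) \<noteq> vanishing_on C T"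
  shows "\<delta> \<le> card (S - T)"
    and "card (vanishing_on C T)
           \<le> CARD('a) ^ (card (S - T) - (\<delta> - 1)) * card (vanishing_on C (T \<union> S))"
proof -
  show "\<delta> \<le> card (S - T)"
  proof (rule ccontr)
    assume "\<not> \<delta> \<le> card (S - T)"
    then have "vanishing_on C T \<subseteq> vanishing_on C S"
      using local_code_erasure[OF carrier zero S dist] by (meson not_le subsetI)
    then have "vanishing_on C (T \<union> S) = vanishing_on C T"
      by (auto simp: vanishing_on_def)
    with ne show False by contradiction
  qed
  then obtain R where R: "R \<subseteq> S - T" "card R = \<delta> - 1"
    by (meson diff_le_self le_trans obtain_subset_with_card_n)
  have finS: "finite S" using S finite_subset by blast
  let ?A = "S - T - R"
  have "card (vanishing_on C (T \<union> S)) = card (vanishing_on C (T \<union> ?A))"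
  \<comment> \<open>For \<open>\<delta> = 0\<close> no set has fewer than \<open>\<delta>\<close>
    elements, so the erasure lemma cannot be used; but then the truncated
    \<open>\<delta> - 1\<close> is 0 and nothing is left out.\<close>
  proof (cases "\<delta> = 0")
    case True
    then have "R = {}" using R finS by (auto simp: finite_subset card_eq_0_iff)
    then show ?thesis by simp
  next
    case False
    have "S - (T \<union> ?A) = R" using R by auto
    then have "card (S - (T \<union> ?A)) < \<delta>" using R False by simp
    then have "vanishing_on C (T \<union> ?A) \<subseteq> vanishing_on C S"
      using local_code_erasure[OF carrier zero S dist] by blast
    then have "vanishing_on C (T \<union> S) = vanishing_on C (T \<union> ?A)"
      by (auto simp: vanishing_on_def)
    then show ?thesis by simp
  qed
  moreover have "card (vanishing_on C T)
      \<le> CARD('a) ^ card ?A * card (vanishing_on (vanishing_on C T) ?A)"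
  proof (rule card_le_card_vanishing_on)
    show "finite (vanishing_on C T)"
      using finite_subset[OF carrier finite_carrier_vec] by (rule finite_vanishing_on)
    show "vanishing_on C T \<subseteq> carrier_vec n" using carrier by (auto simp: vanishing_on_def)
    show "x - y \<in> vanishing_on C T" if "x \<in> vanishing_on C T" "y \<in> vanishing_on C T" for x y
      using that diff carrier T by (auto simp: vanishing_on_def subset_iff)
  qed (use S in auto)
  moreover have "card ?A = card (S - T) - (\<delta> - 1)"
    using R finS by (simp add: card_Diff_subset finite_subset)
  ultimately show "card (vanishing_on C T)
           \<le> CARD('a) ^ (card (S - T) - (\<delta> - 1)) * card (vanishing_on C (T \<union> S))"
    by (simp add: vanishing_on_Un)
qed

text \<open>In rank terms, the cardinality bound obtained here is
  $|T| \ge \mathrm{rank}(T) + m(\delta - 1)$.\<close>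

lemma exists_union_of_local_supports:
  fixes C :: "'a::{field,finite} vec set"
  assumes carrier: "C \<subseteq> carrier_vec n" and zero: "0\<^sub>v n \<in> C"
    and diff: "\<And>x y. x \<in> C \<Longrightarrow> y \<in> C \<Longrightarrow> x - y \<in> C"
    and nontrivial: "\<not> C \<subseteq> {0\<^sub>v n}"
    and big: "CARD('a) ^ k \<le> card C"
    and S: "\<And>i. i \<in> L \<Longrightarrow> S i \<subseteq> {..<n}"
    and size: "\<And>i. i \<in> L \<Longrightarrow> card (S i) \<le> r + \<delta> - 1"
    and dist: "\<And>i. i \<in> L \<Longrightarrow> enat \<delta> \<le> min_dist (punctured_code C (S i))"
    and info: "vanishing_on C (\<Union>i\<in>L. S i) \<subseteq> {0\<^sub>v n}"
    and \<delta>: "\<delta> \<ge> 1"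
  obtains T m where "T \<subseteq> {..<n}" "\<not> vanishing_on C T \<subseteq> {0\<^sub>v n}"
    "CARD('a) ^ (k + m * (\<delta> - 1)) \<le> CARD('a) ^ card T * card (vanishing_on C T)"
    "k \<le> (m + 1) * r"
proof -
  let ?q = "CARD('a)"
  \<comment> \<open>Invariants after \<open>m\<close> additions, with ranks written as exponents of
    the field size. The last conjunct bounds the rank by \<open>m * r\<close> when $|C| = q^k$.
    \<open>P\<close> records only these inequalities, not which supports were added.\<close>
  define P where "P T m \<longleftrightarrow> T \<subseteq> {..<n} \<and> \<not> vanishing_on C T \<subseteq> {0\<^sub>v n} \<and>
      ?q ^ (k + m * (\<delta> - 1)) \<le> ?q ^ card T * card (vanishing_on C T) \<and>
      ?q ^ k \<le> ?q ^ (m * r) * card (vanishing_on C T)" for T m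
  have q: "1 < ?q"
    using card_mono[of UNIV "{0, 1 :: 'a}"] by simp
  have "P {} 0" using nontrivial big by (simp add: P_def vanishing_on_def)
  moreover have "finite {T. \<exists>m. P T m}"
    by (rule finite_subset[of _ "Pow {..<n}"]) (auto simp: P_def)
  \<comment> \<open>An inclusion-maximal \<open>T\<close> replaces the iteration of the greedy
    process.\<close>
  ultimately obtain T where T: "T \<in> {T. \<exists>m. P T m}"
    and maxT: "\<And>T'. T' \<in> {T. \<exists>m. P T m} \<Longrightarrow> T \<subseteq> T' \<Longrightarrow> T = T'"
    using finite_has_maximal[of "{T. \<exists>m. P T m}"] by blast
  then obtain m where m: "P T m" by blast
  then have Tn: "T \<subseteq> {..<n}" and Tne: "\<not> vanishing_on C T \<subseteq> {0\<^sub>v n}"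
    and T1: "?q ^ (k + m * (\<delta> - 1)) \<le> ?q ^ card T * card (vanishing_on C T)"
    and T2: "?q ^ k \<le> ?q ^ (m * r) * card (vanishing_on C T)"
    unfolding P_def by blast+
  \<comment> \<open>Otherwise words vanishing on \<open>T\<close> would vanish on all local
    supports, an information set.\<close>
  have "\<exists>i\<in>L. vanishing_on C (T \<union> S i) \<noteq> vanishing_on C T"
  proof (rule ccontr)
    assume "\<not> ?thesis"
    then have "vanishing_on C T \<subseteq> vanishing_on C (\<Union>i\<in>L. S i)"
      by (fastforce simp: vanishing_on_def)
    with info Tne show False by blast
  qed
  then obtain i where i: "i \<in> L" and ne: "vanishing_on C (T \<union> S i) \<noteq> vanishing_on C T"
    by blast
  let ?a = "card (S i - T)" and ?K = "card (vanishing_on C T)"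
    and ?K' = "card (vanishing_on C (T \<union> S i))"
  have a: "\<delta> \<le> ?a" and K: "?K \<le> ?q ^ (?a - (\<delta> - 1)) * ?K'"
    using add_local_support[OF carrier zero diff S[OF i] Tn dist[OF i] ne] by blast+
  have finS: "finite (S i)" "finite T"
    using S[OF i] Tn finite_subset by blast+
  have "?a \<le> card (S i)" using finS by (intro card_mono) auto
  then have ar: "?a - (\<delta> - 1) \<le> r" using size[OF i] \<delta> by linarith
  have Kr: "?K \<le> ?q ^ r * ?K'"
    using K ar q by (meson le_trans mult_le_mono1 one_le_card_finite power_increasing less_imp_le)
  have S2: "?q ^ k \<le> ?q ^ ((m + 1) * r) * ?K'"
  proof -
    have "?q ^ k \<le> ?q ^ (m * r) * (?q ^ r * ?K')"
      using T2 Kr by (meson le_trans mult_le_mono2)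
    then show ?thesis by (simp add: power_add algebra_simps)
  qed
  have S1: "?q ^ (k + (m + 1) * (\<delta> - 1)) \<le> ?q ^ card (T \<union> S i) * ?K'"
  proof -
    have "?q ^ (k + (m + 1) * (\<delta> - 1)) = ?q ^ (k + m * (\<delta> - 1)) * ?q ^ (\<delta> - 1)"
      by (simp only: power_add[symmetric] add_mult_distrib nat_mult_1 add.assoc)
    also have "\<dots> \<le> ?q ^ card T * ?K * ?q ^ (\<delta> - 1)"
      using T1 by (rule mult_le_mono1)
    also have "\<dots> \<le> ?q ^ card T * (?q ^ (?a - (\<delta> - 1)) * ?K') * ?q ^ (\<delta> - 1)"
      using K by simp
    also have "\<dots> = ?q ^ (card T + (?a - (\<delta> - 1)) + (\<delta> - 1)) * ?K'"
      by (simp only: power_add mult.assoc mult.commute mult.left_commute)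
    also have "card T + (?a - (\<delta> - 1)) + (\<delta> - 1) = card (T \<union> S i)"
      using a finS card_Un_disjoint[of T "S i - T"] by simp
    finally show ?thesis .
  qed
  \<comment> \<open>\<open>S1\<close> and \<open>S2\<close> are the invariants for
    \<open>m + 1\<close>, so by maximality only nontriviality can fail. \<open>S2\<close> then still
    yields \<open>k \<le> (m + 1) * r\<close>, while \<open>T\<close> itself keeps a nonzero
    codeword.\<close>
  have trivial: "vanishing_on C (T \<union> S i) \<subseteq> {0\<^sub>v n}"
  proof (rule ccontr)
    assume "\<not> ?thesis"
    then have "P (T \<union> S i) (m + 1)"
      unfolding P_def using S1 S2 Tn S[OF i] by blast
    then have "T = T \<union> S i" using maxT by blast
    with ne show False by simp
  qed
  then have "?K' \<le> 1" using card_mono[OF _ trivial] by simp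
  then have "?q ^ k \<le> ?q ^ ((m + 1) * r)"
    using S2 by (metis le_trans mult.right_neutral mult_le_mono2)
  then have "k \<le> (m + 1) * r" using q by (simp only: power_increasing_iff)
  with that Tn Tne T1 show thesis by blast
qed

section \<open>Filling up with single coordinates\<close>

text \<open>Adding a coordinate multiplies the power of the field size by \<open>CARD('a)\<close>
  and shrinks the subcode by at most that factor, so the inequality \<open>e\<close> persists. At a
  maximal \<open>T'\<close> one more coordinate leaves at most one codeword; this coordinate is the
  \<open>+ 1\<close> in the conclusion.\<close>

lemma exists_large_vanishing_set:
  fixes C :: "'a::{field,finite} vec set"
  assumes carrier: "C \<subseteq> carrier_vec n"
    and diff: "\<And>x y. x \<in> C \<Longrightarrow> y \<in> C \<Longrightarrow> x - y \<in> C"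
    and T: "T \<subseteq> {..<n}" "\<not> vanishing_on C T \<subseteq> {0\<^sub>v n}"
    and e: "CARD('a) ^ e \<le> CARD('a) ^ card T * card (vanishing_on C T)"
  obtains T' where "T' \<subseteq> {..<n}" "\<not> vanishing_on C T' \<subseteq> {0\<^sub>v n}" "e \<le> card T' + 1"
proof -
  let ?q = "CARD('a)"
  define F where "F = {T. T \<subseteq> {..<n} \<and> \<not> vanishing_on C T \<subseteq> {0\<^sub>v n} \<and>
      ?q ^ e \<le> ?q ^ card T * card (vanishing_on C T)}"
  have q: "1 < ?q"
    using card_mono[of UNIV "{0, 1 :: 'a}"] by simp
  have "T \<in> F" using T e by (simp add: F_def)
  moreover have "finite F"
    by (rule finite_subset[of _ "Pow {..<n}"]) (auto simp: F_def)
  ultimately obtain T' where T': "T' \<in> F" and maxT: "\<And>T''. T'' \<in> F \<Longrightarrow> T' \<subseteq> T'' \<Longrightarrow> T' = T''"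
    using finite_has_maximal[of F] by blast
  then have Tn: "T' \<subseteq> {..<n}" and Tne: "\<not> vanishing_on C T' \<subseteq> {0\<^sub>v n}"
    and T1: "?q ^ e \<le> ?q ^ card T' * card (vanishing_on C T')"
    unfolding F_def by blast+
  \<comment> \<open>A word vanishing everywhere is zero, so \<open>T'\<close> misses some
    coordinate.\<close>
  have "vanishing_on C {..<n} \<subseteq> {0\<^sub>v n}"
    using carrier by (auto simp: vanishing_on_def intro!: eq_vecI)
  then obtain j where j: "j < n" "j \<notin> T'"
    using Tn Tne by (metis lessThan_iff subsetI subset_antisym)
  let ?K' = "card (vanishing_on C (T' \<union> {j}))"
  have K: "card (vanishing_on C T') \<le> ?q * ?K'"
    unfolding vanishing_on_Un
  proof (rule card_le_card_vanishing_on_singleton)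
    show "finite (vanishing_on C T')"
      using finite_subset[OF carrier finite_carrier_vec] by (rule finite_vanishing_on)
    show "vanishing_on C T' \<subseteq> carrier_vec n" using carrier by (auto simp: vanishing_on_def)
    show "x - y \<in> vanishing_on C T'" if "x \<in> vanishing_on C T'" "y \<in> vanishing_on C T'" for x y
      using that diff carrier Tn by (auto simp: vanishing_on_def subset_iff)
  qed (use j in auto)
  then have T2: "?q ^ e \<le> ?q ^ card T' * (?q * ?K')"
    using T1 by (meson le_trans mult_le_mono2)
  have "finite T'" using Tn finite_subset by blast
  then have cT: "card (T' \<union> {j}) = card T' + 1" using j by simp
  have trivial: "vanishing_on C (T' \<union> {j}) \<subseteq> {0\<^sub>v n}"
  proof (rule ccontr)
    assume "\<not> ?thesis"
    then have "T' \<union> {j} \<in> F"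
      unfolding F_def using T2 cT Tn j by (simp add: algebra_simps)
    with maxT j show False by blast
  qed
  then have "?K' \<le> 1" using card_mono[OF _ trivial] by simp
  then have "?q ^ e \<le> ?q ^ card T' * (?q * 1)"
    using T2 by (meson le_trans mult_le_mono2)
  then have "?q ^ e \<le> ?q ^ (card T' + 1)" by (simp add: mult.commute)
  then have "e \<le> card T' + 1" using q by (simp only: power_increasing_iff)
  with that Tn Tne show thesis by blast
qed

section \<open>From vanishing sets to the distance bound\<close>

lemma min_dist_le_length_minus_vanishing:
  assumes carrier: "C \<subseteq> carrier_vec n" and zero: "0\<^sub>v n \<in> C" and d: "min_dist C = enat d"
    and T: "T \<subseteq> {..<n}" "\<not> vanishing_on C T \<subseteq> {0\<^sub>v n}"
  shows "d + card T \<le> n"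
proof -
  obtain c where c: "c \<in> C" "\<And>j. j \<in> T \<Longrightarrow> c $ j = 0" "c \<noteq> 0\<^sub>v n"
    using T(2) by (auto simp: vanishing_on_def)
  have cn: "dim_vec c = n" using c carrier by auto
  have finT: "finite T" using T finite_subset by blast
  have "d \<le> hamming_dist c (0\<^sub>v n)"
    using min_dist_le_hamming_dist[of d C c "0\<^sub>v n"] d c zero by simp
  also have "\<dots> \<le> card ({..<n} - T)"
    unfolding hamming_dist_def using c cn by (intro card_mono) auto
  also have "\<dots> = n - card T"
    using T finT by (simp add: card_Diff_subset)
  finally show ?thesis using card_mono[OF _ T(1)] by simp
qed

lemma generated_code_closed:
  fixes C :: "'a::{field,finite} vec set"
  assumes "generator_matrix n k C G"
  shows "C \<subseteq> carrier_vec n" "0\<^sub>v n \<in> C" "\<And>x y. x \<in> C \<Longrightarrow> y \<in> C \<Longrightarrow> x - y \<in> C"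
proof -
  have G: "G \<in> carrier_mat k n" using assms by (simp add: generator_matrix_def)
  have C: "C = {w \<in> carrier_vec n. \<exists>y\<in>carrier_vec k. G\<^sup>T *\<^sub>v y = w}"
    using assms G vec_space.row_space_eq[OF G] by (auto simp: generator_matrix_def)
  show "C \<subseteq> carrier_vec n" unfolding C by blast
  have "G\<^sup>T *\<^sub>v 0\<^sub>v k = 0\<^sub>v n" using G by (intro eq_vecI) auto
  then show "0\<^sub>v n \<in> C" unfolding C by auto
  fix x y assume "x \<in> C" "y \<in> C"
  then obtain a b where ab: "a \<in> carrier_vec k" "b \<in> carrier_vec k"
    "x = G\<^sup>T *\<^sub>v a" "y = G\<^sup>T *\<^sub>v b" "x \<in> carrier_vec n" "y \<in> carrier_vec n"
    unfolding C by blast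
  then have "G\<^sup>T *\<^sub>v (a - b) = x - y"
    using G mult_minus_distrib_mat_vec[of "G\<^sup>T" n k a b] by simp
  with ab show "x - y \<in> C" unfolding C by auto
qed

theorem mainTheorem1:
  fixes C :: "'a::{field,finite} vec set"
    and G :: "'a mat"
    and n k d r \<delta> :: nat
  assumes "r \<ge> 1" and "\<delta> \<ge> 2"
    and "linear_code n k d C"
    and "generator_matrix n k C G"
    and "information_locality n k C G r \<delta>"
  shows "int d \<le> int n - int k + 1 - (\<lceil>real k / real r\<rceil> - 1) * (int \<delta> - 1)"
proof -
  note closed = generated_code_closed[OF assms(4)]
  have d: "min_dist C = enat d" using assms(3) by (simp add: linear_code_def)
  have nontrivial: "\<not> C \<subseteq> {0\<^sub>v n}"
  proof
    assume "C \<subseteq> {0\<^sub>v n}"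
    \<comment> \<open>The zero code has no two distinct words, so its minimum distance is the
      infimum of the empty set, which is not a natural number.\<close>
    then have "{enat (hamming_dist x y) | x y. x \<in> C \<and> y \<in> C \<and> x \<noteq> y} = {}" by blast
    then have "min_dist C = \<infinity>" by (simp only: min_dist_def) (simp add: top_enat_def)
    then show False using d by simp
  qed
  obtain L :: "nat set" and S :: "nat \<Rightarrow> nat set" where loc: "\<And>i. i \<in> L \<Longrightarrow> S i \<subseteq> {..<n}"
      "\<And>i. i \<in> L \<Longrightarrow> card (S i) \<le> r + \<delta> - 1"
      "\<And>i. i \<in> L \<Longrightarrow> enat \<delta> \<le> min_dist (punctured_code C (S i))"
    and rank: "vec_space.rank k (submatrix G UNIV (\<Union>i\<in>L. S i)) = k"
    using assms(5) unfolding information_locality_def by blast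
  have "(\<Union>i\<in>L. S i) \<subseteq> {..<n}" using loc(1) by blast
  note info = full_rank_columns_information_set[OF assms(4) this rank]
  obtain T m where T: "T \<subseteq> {..<n}" "\<not> vanishing_on C T \<subseteq> {0\<^sub>v n}"
    "CARD('a) ^ (k + m * (\<delta> - 1)) \<le> CARD('a) ^ card T * card (vanishing_on C T)"
    and m: "k \<le> (m + 1) * r"
    by (rule exists_union_of_local_supports[OF closed nontrivial info(2) loc info(1)])
      (use \<open>\<delta> \<ge> 2\<close> in auto)
  obtain T' where T': "T' \<subseteq> {..<n}" "\<not> vanishing_on C T' \<subseteq> {0\<^sub>v n}"
    "k + m * (\<delta> - 1) \<le> card T' + 1"
    using exists_large_vanishing_set[OF closed(1,3) T] by blast
  have "d + card T' \<le> n"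
    using min_dist_le_length_minus_vanishing[OF closed(1,2) d T'(1,2)] .
  then have "d + k + m * (\<delta> - 1) \<le> n + 1" using T'(3) by linarith
  then have "int (d + k + m * (\<delta> - 1)) \<le> int (n + 1)" by (simp only: of_nat_le_iff)
  then have bound: "int d + int k + int m * (int \<delta> - 1) \<le> int n + 1"
    using \<open>\<delta> \<ge> 2\<close> by (simp add: of_nat_diff)
  have "real k \<le> real ((m + 1) * r)" using m by (simp only: of_nat_le_iff)
  then have "real k / real r \<le> real_of_int (int m + 1)"
    using \<open>r \<ge> 1\<close> by (simp add: field_simps)
  \<comment> \<open>The number \<open>m\<close> of greedy steps may exceed this value; since
    \<open>\<delta> - 1\<close> is nonnegative, a larger \<open>m\<close> only strengthens
    \<open>bound\<close>.\<close>
  then have "\<lceil>real k / real r\<rceil> - 1 \<le> int m" by linarith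
  then have "(\<lceil>real k / real r\<rceil> - 1) * (int \<delta> - 1) \<le> int m * (int \<delta> - 1)"
    using \<open>\<delta> \<ge> 2\<close> by (intro mult_right_mono) auto
  with bound show ?thesis by linarith
qed

end
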